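(* For every finite poset $P$ with $k$ points and every positive integer $m$, $$1\le\frac{e(m+1,P)}{d(P)\,e(m,P)}<1+m^{-1}2^k d(P)\le 1+m^{-1}4^k.$$
   Context: $d(P)$ is the number of downsets of $P$. For a finite poset $P$ on $K$ and a finite set $M$ disjoint from $K$ with $|M|=m$, $e(m,P)$ is the number of partial orders on $M\cup K$ inducing $P$ on $K$ whose set of minimal elements is exactly $M$. *)

theory Defs
  imports Complex_Main
begin

text \<open>
  A poset on a ground set \<open>K\<close> is a relation \<open>r\<close> with \<open>partial_order_on K r\<close>,
  where \<open>(x, y) \<in> r\<close> means \<open>x \<le> y\<close>; in particular \<open>r \<subseteq> K \<times> K\<close> and \<open>r\<close> is reflexive on \<open>K\<close>.
\<close>

definition downsets :: "'a set \<Rightarrow> 'a rel \<Rightarrow> 'a set set" where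
  "downsets K r = {D. D \<subseteq> K \<and> (\<forall>x\<in>D. \<forall>y\<in>K. (y, x) \<in> r \<longrightarrow> y \<in> D)}"

definition num_downsets :: "'a set \<Rightarrow> 'a rel \<Rightarrow> nat" where
  "num_downsets K r = card (downsets K r)"

definition minimal_elements :: "'a set \<Rightarrow> 'a rel \<Rightarrow> 'a set" where
  "minimal_elements A s = {x \<in> A. \<forall>y\<in>A. (y, x) \<in> s \<longrightarrow> y = x}"

definition extensions_by_minimals :: "'a set \<Rightarrow> 'a set \<Rightarrow> 'a rel \<Rightarrow> 'a rel set" where
  "extensions_by_minimals M K r =
     {s. partial_order_on (M \<union> K) s \<and> s \<inter> (K \<times> K) = r \<and> minimal_elements (M \<union> K) s = M}"

text \<open>
  The number \<open>e(m, P)\<close> depends on the set \<open>M\<close> of new points only through its cardinality.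
  The definition uses the standard disjoint copy \<open>{..<m}\<close>, placed in the second summand of
  \<open>'a + nat\<close> because \<open>'a\<close> itself may have too few elements outside \<open>K\<close>;
  \<open>num_extensions_eq\<close> below shows that any other choice of \<open>M\<close> gives the same number.
\<close>

definition num_extensions :: "nat \<Rightarrow> 'a set \<Rightarrow> 'a rel \<Rightarrow> nat" where
  "num_extensions m K r =
     card (extensions_by_minimals (Inr ` {..<m} :: ('a + nat) set) (Inl ` K) (map_prod Inl Inl ` r))"

lemma map_prod_image_iff:
  assumes "inj_on f A" "s \<subseteq> A \<times> A" "x \<in> A" "y \<in> A"
  shows "(f x, f y) \<in> map_prod f f ` s \<longleftrightarrow> (x, y) \<in> s"
proof
  assume "(f x, f y) \<in> map_prod f f ` s"
  then obtain a b where ab: "(a, b) \<in> s" "f x = f a" "f y = f b" by auto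
  moreover have "a \<in> A" "b \<in> A" using ab(1) assms(2) by auto
  ultimately show "(x, y) \<in> s" using assms by (metis inj_onD)
qed force

lemma extensions_by_minimals_image:
  assumes f: "inj_on f (M \<union> K)" and r: "r \<subseteq> K \<times> K"
    and s: "s \<in> extensions_by_minimals M K r"
  shows "map_prod f f ` s \<in> extensions_by_minimals (f ` M) (f ` K) (map_prod f f ` r)"
proof -
  let ?A = "M \<union> K" and ?t = "map_prod f f ` s"
  have po: "s \<subseteq> ?A \<times> ?A" "\<And>x. x \<in> ?A \<Longrightarrow> (x, x) \<in> s" "trans s" "antisym s"
    and res: "s \<inter> (K \<times> K) = r" and min: "minimal_elements ?A s = M"
    using s unfolding extensions_by_minimals_def partial_order_on_def preorder_on_def refl_on_def
    by auto
  note iff = map_prod_image_iff[OF f po(1)]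
  have sub: "?t \<subseteq> f ` ?A \<times> f ` ?A" using po(1) by auto
  have "refl_on (f ` ?A) ?t" using po(2) by (auto simp: refl_on_def)
  moreover have "trans ?t"
  proof (rule transI)
    fix x y z assume xy: "(x, y) \<in> ?t" and yz: "(y, z) \<in> ?t"
    then have "x \<in> f ` ?A" "y \<in> f ` ?A" "z \<in> f ` ?A" using sub by blast+
    then obtain a b c where abc: "x = f a" "y = f b" "z = f c" "a \<in> ?A" "b \<in> ?A" "c \<in> ?A"
      by (elim imageE) blast
    then have "(a, b) \<in> s" "(b, c) \<in> s" using xy yz iff by simp_all
    then have "(a, c) \<in> s" using po(3) by (metis transD)
    then show "(x, z) \<in> ?t" using abc iff by simp
  qed
  moreover have "antisym ?t"
  proof (rule antisymI)
    fix x y assume xy: "(x, y) \<in> ?t" and yx: "(y, x) \<in> ?t"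
    then have "x \<in> f ` ?A" "y \<in> f ` ?A" using sub by blast+
    then obtain a b where ab: "x = f a" "y = f b" "a \<in> ?A" "b \<in> ?A"
      by (elim imageE) blast
    then have "(a, b) \<in> s" "(b, a) \<in> s" using xy yx iff by simp_all
    then have "a = b" using po(4) by (metis antisymD)
    then show "x = y" using ab by simp
  qed
  ultimately have 1: "partial_order_on (f ` M \<union> f ` K) ?t"
    using sub by (simp add: partial_order_on_def preorder_on_def image_Un)
  have 2: "?t \<inter> (f ` K \<times> f ` K) = map_prod f f ` r"
  proof
    show "?t \<inter> (f ` K \<times> f ` K) \<subseteq> map_prod f f ` r"
    proof
      fix p assume p: "p \<in> ?t \<inter> (f ` K \<times> f ` K)"
      then obtain a b where ab: "p = (f a, f b)" "a \<in> K" "b \<in> K" by auto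
      then have "(a, b) \<in> s" using p iff by auto
      then show "p \<in> map_prod f f ` r" using ab res by force
    qed
    show "map_prod f f ` r \<subseteq> ?t \<inter> (f ` K \<times> f ` K)" using res r by force
  qed
  have eqf: "f y = f x \<longleftrightarrow> y = x" if "x \<in> ?A" "y \<in> ?A" for x y
    using that f by (meson inj_onD)
  have "minimal_elements (f ` ?A) ?t = f ` minimal_elements ?A s"
  proof -
    have "f x \<in> minimal_elements (f ` ?A) ?t \<longleftrightarrow> x \<in> minimal_elements ?A s" if "x \<in> ?A" for x
    proof -
      have "f x \<in> minimal_elements (f ` ?A) ?t \<longleftrightarrow> (\<forall>y\<in>?A. (f y, f x) \<in> ?t \<longrightarrow> f y = f x)"
        unfolding minimal_elements_def mem_Collect_eq ball_simps(9)
        using that by (simp only: imageI simp_thms)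
      also have "\<dots> \<longleftrightarrow> (\<forall>y\<in>?A. (y, x) \<in> s \<longrightarrow> y = x)"
        using that by (intro ball_cong refl) (simp only: iff eqf)
      finally show ?thesis using that by (simp add: minimal_elements_def)
    qed
    moreover have "minimal_elements (f ` ?A) ?t \<subseteq> f ` ?A" "minimal_elements ?A s \<subseteq> ?A"
      by (auto simp: minimal_elements_def)
    ultimately show ?thesis by blast
  qed
  then have 3: "minimal_elements (f ` M \<union> f ` K) ?t = f ` M"
    by (simp add: min image_Un)
  show ?thesis using 1 2 3 by (simp add: extensions_by_minimals_def)
qed

lemma card_extensions_by_minimals_le:
  assumes f: "inj_on f (M \<union> K)" and r: "r \<subseteq> K \<times> K" and fin: "finite M" "finite K"
  shows "card (extensions_by_minimals M K r)
       \<le> card (extensions_by_minimals (f ` M) (f ` K) (map_prod f f ` r))"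
proof (rule card_inj_on_le)
  show "(`) (map_prod f f) ` extensions_by_minimals M K r
      \<subseteq> extensions_by_minimals (f ` M) (f ` K) (map_prod f f ` r)"
    using extensions_by_minimals_image[OF f r] by blast
  have "extensions_by_minimals M K r \<subseteq> Pow ((M \<union> K) \<times> (M \<union> K))"
    by (auto simp: extensions_by_minimals_def partial_order_on_def preorder_on_def)
  moreover have "inj_on (map_prod f f) ((M \<union> K) \<times> (M \<union> K))"
    using f by (auto simp: inj_on_def)
  ultimately show "inj_on ((`) (map_prod f f)) (extensions_by_minimals M K r)"
    by (meson inj_on_image_Pow inj_on_subset)
  have "extensions_by_minimals (f ` M) (f ` K) (map_prod f f ` r)
      \<subseteq> Pow ((f ` M \<union> f ` K) \<times> (f ` M \<union> f ` K))"
    by (auto simp: extensions_by_minimals_def partial_order_on_def preorder_on_def)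
  then show "finite (extensions_by_minimals (f ` M) (f ` K) (map_prod f f ` r))"
    by (rule finite_subset) (simp add: fin)
qed

lemma card_extensions_by_minimals_image:
  assumes f: "inj_on f (M \<union> K)" and r: "r \<subseteq> K \<times> K" and fin: "finite M" "finite K"
  shows "card (extensions_by_minimals (f ` M) (f ` K) (map_prod f f ` r))
       = card (extensions_by_minimals M K r)"
proof (rule antisym)
  define g where "g = inv_into (M \<union> K) f"
  have gf: "g (f x) = x" if "x \<in> M \<union> K" for x
    unfolding g_def using inv_into_f_f[OF f that] .
  have "g ` f ` M = M" "g ` f ` K = K"
    using gf by (simp_all add: image_image)
  moreover have "map_prod g g ` map_prod f f ` r = r"
  proof -
    have "map_prod g g (map_prod f f p) = p" if "p \<in> r" for p
      using that r gf by (cases p) auto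
    then show ?thesis by (simp add: image_image)
  qed
  moreover have "map_prod f f ` r \<subseteq> f ` K \<times> f ` K" using r by auto
  moreover have "inj_on g (f ` M \<union> f ` K)"
    by (rule inj_on_inverseI[where g = f]) (use gf in auto)
  ultimately show "card (extensions_by_minimals (f ` M) (f ` K) (map_prod f f ` r))
      \<le> card (extensions_by_minimals M K r)"
    using card_extensions_by_minimals_le[of g "f ` M" "f ` K" "map_prod f f ` r"] fin by simp
qed (rule card_extensions_by_minimals_le[OF assms])

lemma num_extensions_eq:
  assumes "partial_order_on K r" "finite K" "finite M" "M \<inter> K = {}" "card M = m"
  shows "num_extensions m K r = card (extensions_by_minimals M K r)"
proof -
  have r: "r \<subseteq> K \<times> K" using assms(1) by (simp add: partial_order_on_def preorder_on_def)
  obtain g where g: "bij_betw g M {..<m}"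
    using assms(3,5) by (metis bij_betw_iff_card card_lessThan finite_lessThan)
  define f where "f = (\<lambda>x. if x \<in> K then Inl x else Inr (g x))"
  have M: "x \<notin> K" if "x \<in> M" for x using that assms(4) by auto
  have "inj_on f (M \<union> K)"
    using g M by (auto simp: inj_on_def f_def bij_betw_def)
  moreover have "f ` M = Inr ` {..<m}"
  proof -
    have "f ` M = Inr ` g ` M" using M by (auto simp: f_def image_iff)
    then show ?thesis using g by (simp add: bij_betw_def)
  qed
  moreover have "f ` K = Inl ` K" by (simp add: f_def)
  moreover have "map_prod f f ` r = map_prod Inl Inl ` r"
    using r by (intro image_cong) (auto simp: f_def)
  ultimately show ?thesis
    using card_extensions_by_minimals_image[of f M K r] r assms(2,3)
    by (simp add: num_extensions_def)
qed

end

theory Submission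
  imports Defs
begin

text \<open>
  An extension is determined by the upsets \<open>U\<^sub>a \<subseteq> K\<close> of points above each \<open>a \<in> M\<close>, and these may be
  arbitrary upsets with union \<open>K\<close>; so \<open>e(m, P)\<close> counts the covers of \<open>K\<close> by \<open>m\<close> upsets, in order.
  Adding any upset to an \<open>m\<close>-cover gives the lower bound. For the upper bound, consider a cover
  \<open>(U, U\<^sub>1, \<dots>, U\<^sub>m)\<close> in which \<open>U\<close> is essential, together with an index \<open>i \<le> m\<close>. Replacing \<open>U\<^sub>i\<close> by
  \<open>U\<^sub>i \<union> U\<close> yields an \<open>m\<close>-cover, in which a point \<open>x\<close> missed by \<open>U\<^sub>1, \<dots>, U\<^sub>m\<close> lies in the \<open>i\<close>-th set
  only. Hence the \<open>m\<close>-cover, \<open>x\<close>, \<open>U\<close> and \<open>U\<^sub>i\<close> determine everything, and there are at most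
  \<open>e(m, P) k d(P)\<^sup>2 / m\<close> covers of this kind, where \<open>k < 2\<^sup>k\<close>.
\<close>

section \<open>Upsets and ordered covers by upsets\<close>

definition upsets :: "'a set \<Rightarrow> 'a rel \<Rightarrow> 'a set set" where
  "upsets K r = {U. U \<subseteq> K \<and> (\<forall>x\<in>U. \<forall>y\<in>K. (x, y) \<in> r \<longrightarrow> y \<in> U)}"

text \<open>Lists rather than families of sets, because the new points are labelled: order and
  repetition count, and entries may be empty.\<close>

definition upset_covers :: "nat \<Rightarrow> 'a set \<Rightarrow> 'a rel \<Rightarrow> 'a set list set" where
  "upset_covers m K r = {us. length us = m \<and> set us \<subseteq> upsets K r \<and> \<Union>(set us) = K}"

lemma upsets_Un: "U \<in> upsets K r \<Longrightarrow> V \<in> upsets K r \<Longrightarrow> U \<union> V \<in> upsets K r"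
  by (auto simp: upsets_def)

lemma ground_set_in_upsets: "K \<in> upsets K r"
  by (auto simp: upsets_def)

lemma finite_upsets: "finite K \<Longrightarrow> finite (upsets K r)"
  by (rule finite_subset[of _ "Pow K"]) (auto simp: upsets_def)

text \<open>Complementation in \<open>K\<close> exchanges upsets and downsets.\<close>

lemma card_upsets: "card (upsets K r) = num_downsets K r"
  unfolding num_downsets_def
  by (rule bij_betw_same_card[of "\<lambda>U. K - U"],
      rule bij_betw_byWitness[where f' = "\<lambda>U. K - U"])
     (auto simp: upsets_def downsets_def)

lemma num_downsets_le: "finite K \<Longrightarrow> num_downsets K r \<le> 2 ^ card K"
  unfolding num_downsets_def card_Pow[symmetric]
  by (rule card_mono) (auto simp: downsets_def)

lemma finite_upset_covers:
  assumes "finite K"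
  shows "finite (upset_covers m K r)"
proof (rule finite_subset)
  show "finite {us. set us \<subseteq> upsets K r \<and> length us = m}"
    using finite_upsets[OF assms] by (rule finite_lists_length_eq)
qed (auto simp: upset_covers_def)

text \<open>This makes the denominator of the ratio positive. Take \<open>m\<close> copies of
  \<open>K\<close>; \<open>m \<ge> 1\<close> ensures that their union is \<open>K\<close> even when
  \<open>K\<close> is nonempty.\<close>

lemma upset_covers_nonempty: "m \<ge> 1 \<Longrightarrow> upset_covers m K r \<noteq> {}"
proof -
  assume "m \<ge> 1"
  then have "replicate m K \<in> upset_covers m K r"
    using ground_set_in_upsets[of K r] by (auto simp: upset_covers_def)
  then show ?thesis by blast
qed

section \<open>Correspondence between extensions and covers\<close>

definition extension_of_cover :: "'a rel \<Rightarrow> 'a set list \<Rightarrow> ('a + nat) rel" where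
  "extension_of_cover r us = map_prod Inl Inl ` r \<union> Id_on (Inr ` {..<length us})
     \<union> {(Inr i, Inl x) |i x. i < length us \<and> x \<in> us ! i}"

definition cover_of_extension :: "nat \<Rightarrow> ('a + nat) rel \<Rightarrow> 'a set list" where
  "cover_of_extension m s = map (\<lambda>i. {x. (Inr i, Inl x) \<in> s}) [0..<m]"

lemma extension_of_cover_iffs [simp]:
  "(Inl x, Inl y) \<in> extension_of_cover r us \<longleftrightarrow> (x, y) \<in> r"
  "(Inr i, Inl y) \<in> extension_of_cover r us \<longleftrightarrow> i < length us \<and> y \<in> us ! i"
  "(Inl x, Inr j) \<notin> extension_of_cover r us"
  "(Inr i, Inr j) \<in> extension_of_cover r us \<longleftrightarrow> i = j \<and> i < length us"
  by (auto simp: extension_of_cover_def map_prod_def)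

lemma cover_of_extension_of_cover:
  "length us = m \<Longrightarrow> cover_of_extension m (extension_of_cover r us) = us"
  by (auto simp: cover_of_extension_def intro!: nth_equalityI)

text \<open>Transitivity holds because the entries are upsets. Covering puts a new point below every
  old one, so no old point is minimal.\<close>

lemma extension_of_cover_mem:
  assumes po: "partial_order_on K r" and us: "us \<in> upset_covers m K r"
  shows "extension_of_cover r us
    \<in> extensions_by_minimals (Inr ` {..<m}) (Inl ` K) (map_prod Inl Inl ` r)"
proof -
  let ?s = "extension_of_cover r us" and ?A = "Inr ` {..<m} \<union> Inl ` K"
  have r: "r \<subseteq> K \<times> K" "refl_on K r" "trans r" "antisym r"
    using po by (auto simp: partial_order_on_def preorder_on_def)
  have len: "length us = m" and un: "\<Union>(set us) = K"
    and up: "\<And>i. i < m \<Longrightarrow> us ! i \<in> upsets K r"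
    using us by (auto simp: upset_covers_def)
  have sub: "?s \<subseteq> ?A \<times> ?A"
  proof -
    have "us ! i \<subseteq> K" if "i < m" for i using un len that by auto
    then show ?thesis using r(1) len by (auto simp: extension_of_cover_def) blast+
  qed
  have refl: "refl_on ?A ?s"
    using r(2) by (auto simp: refl_on_def len)
  have trans: "trans ?s"
  proof (rule transI)
    fix x y z assume xyz: "(x, y) \<in> ?s" "(y, z) \<in> ?s"
    \<comment> \<open>The one case of transitivity that mixes the two kinds of points: a new point
      below \<open>b\<close>, and \<open>b\<close> below \<open>c\<close> in
      \<open>r\<close>.\<close>
    have up_r: "c \<in> us ! i" if "i < m" "b \<in> us ! i" "(b, c) \<in> r" for i b c
    proof -
      have "c \<in> K" using r(1) that(3) by auto
      then show ?thesis using up[OF that(1)] that(2,3) by (auto simp: upsets_def)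
    qed
    show "(x, z) \<in> ?s"
      using xyz by (cases x; cases y; cases z; simp add: len; metis up_r transD[OF r(3)])
  qed
  have antisym: "antisym ?s"
  proof (rule antisymI)
    fix x y assume "(x, y) \<in> ?s" "(y, x) \<in> ?s"
    then show "x = y" using antisymD[OF r(4)] by (cases x; cases y) auto
  qed
  have "?s \<inter> (Inl ` K \<times> Inl ` K) = map_prod Inl Inl ` r"
    using r(1) by (auto simp: extension_of_cover_def)
  moreover have "minimal_elements ?A ?s = Inr ` {..<m}"
  proof
    show "minimal_elements ?A ?s \<subseteq> Inr ` {..<m}"
    proof
      fix x assume x: "x \<in> minimal_elements ?A ?s"
      show "x \<in> Inr ` {..<m}"
      proof (cases x)
        case (Inl y)
        then have "y \<in> K" using x by (auto simp: minimal_elements_def)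
        then obtain i where i: "i < m" "y \<in> us ! i"
          using un len by (auto simp: in_set_conv_nth)
        then have "(Inr i, x) \<in> ?s" "Inr i \<in> ?A" using len Inl by auto
        then have "Inr i = x" using x unfolding minimal_elements_def by blast
        then show ?thesis using Inl by simp
      qed (use x in \<open>auto simp: minimal_elements_def\<close>)
    qed
  qed (auto simp: minimal_elements_def)
  ultimately show ?thesis
    using sub refl trans antisym
    by (simp add: extensions_by_minimals_def partial_order_on_def preorder_on_def)
qed

text \<open>Transitivity makes the old points above a new one an upset. By finiteness every old
  point lies above a minimal element, which must be new, so these upsets cover
  \<open>K\<close>.\<close>

lemma extension_has_cover:
  assumes fin: "finite K" and po: "partial_order_on K r"
    and s: "s \<in> extensions_by_minimals (Inr ` {..<m}) (Inl ` K) (map_prod Inl Inl ` r)"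
  shows "cover_of_extension m s \<in> upset_covers m K r"
    and "extension_of_cover r (cover_of_extension m s) = s"
proof -
  let ?A = "Inr ` {..<m} \<union> Inl ` K" and ?us = "cover_of_extension m s"
  have spo: "s \<subseteq> ?A \<times> ?A" "refl_on ?A s" "trans s" "antisym s"
    and res: "s \<inter> (Inl ` K \<times> Inl ` K) = map_prod Inl Inl ` r"
    and min: "minimal_elements ?A s = Inr ` {..<m}"
    using s by (auto simp: extensions_by_minimals_def partial_order_on_def preorder_on_def)
  have r: "r \<subseteq> K \<times> K"
    using po by (auto simp: partial_order_on_def preorder_on_def)
  have len: "length ?us = m" by (simp add: cover_of_extension_def)
  have nth: "?us ! i = {x. (Inr i, Inl x) \<in> s}" if "i < m" for i
    using that by (simp add: cover_of_extension_def)
  have LL: "(Inl x, Inl y) \<in> s \<longleftrightarrow> (x, y) \<in> r" for x y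
  proof -
    have "(Inl x, Inl y) \<in> s \<longleftrightarrow> (Inl x, Inl y) \<in> s \<inter> (Inl ` K \<times> Inl ` K)"
      using spo(1) by blast
    also have "\<dots> \<longleftrightarrow> (x, y) \<in> r" unfolding res by (auto simp: map_prod_def)
    finally show ?thesis .
  qed
  \<comment> \<open>New points are minimal, so an extension is free only in its pairs from a new
    point to an old one.\<close>
  have bot: "p = Inr j" if "(p, Inr j) \<in> s" for p j
  proof -
    have "p \<in> ?A" "Inr j \<in> ?A" using that spo(1) by blast+
    then have "Inr j \<in> minimal_elements ?A s" unfolding min by auto
    then show ?thesis using that \<open>p \<in> ?A\<close> unfolding minimal_elements_def by blast
  qed
  have up: "?us ! i \<in> upsets K r" if "i < m" for i
  proof -
    have "y \<in> K" if "(Inr i, Inl y) \<in> s" for y using that spo(1) by auto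
    moreover have "(Inr i, Inl y) \<in> s" if "(Inr i, Inl x) \<in> s" "(x, y) \<in> r" for x y
      using that LL transD[OF spo(3)] by metis
    ultimately show ?thesis unfolding nth[OF that] upsets_def by auto
  qed
  have "K \<subseteq> \<Union>(set ?us)"
  proof
    fix x assume "x \<in> K"
    let ?B = "{y \<in> K. (y, x) \<in> r}"
    have "x \<in> ?B"
      using po \<open>x \<in> K\<close> by (auto simp: partial_order_on_def preorder_on_def refl_on_def)
    txt \<open>A minimal point \<open>y\<close> of \<open>P\<close> below \<open>x\<close> is not minimal in the extension, so some new point
      lies below \<open>y\<close>.\<close>
    let ?R = "r - Id"
    have "trans ?R" "irrefl ?R"
      using po trans_diff_Id
      by (auto simp: partial_order_on_def preorder_on_def irrefl_def)
    then have "acyclic ?R" by (simp add: acyclic_irrefl)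
    moreover have "finite ?R"
      using r fin by (meson finite_Diff finite_SigmaI finite_subset)
    ultimately have "wf ?R" by (simp add: finite_acyclic_wf)
    from wfE_min[OF this \<open>x \<in> ?B\<close>] obtain y
      where y: "y \<in> ?B" "\<And>z. (z, y) \<in> ?R \<Longrightarrow> z \<notin> ?B" by blast
    have "Inl y \<notin> minimal_elements ?A s" unfolding min by auto
    then obtain p where p: "p \<in> ?A" "(p, Inl y) \<in> s" "p \<noteq> Inl y"
      using y(1) unfolding minimal_elements_def by blast
    show "x \<in> \<Union>(set ?us)"
    proof (cases p)
      case (Inl z)
      then have z: "(z, y) \<in> r" "z \<noteq> y" using p LL by auto
      then have "z \<in> ?B"
        using y(1) r po by (auto simp: partial_order_on_def preorder_on_def dest: transD)
      then show ?thesis using y(2) z by blast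
    next
      case (Inr i)
      then have "i < m" using p(1) by auto
      moreover have "(Inl y, Inl x) \<in> s" using y(1) LL by blast
      then have "(Inr i, Inl x) \<in> s" using p(2) transD[OF spo(3)] Inr by blast
      ultimately show ?thesis using nth len by (metis UnionI mem_Collect_eq nth_mem)
    qed
  qed
  moreover have "set ?us \<subseteq> upsets K r"
    using up len by (auto simp: in_set_conv_nth)
  ultimately show "?us \<in> upset_covers m K r"
    using len by (auto simp: upset_covers_def upsets_def)
  show "extension_of_cover r ?us = s"
  proof (rule set_eqI, clarify)
    fix p q :: "'a + nat"
    have "(Inr i, Inl y) \<in> s \<longrightarrow> i < m" for i y using spo(1) by blast
    moreover have "(Inr i, Inr j) \<in> s \<longleftrightarrow> i = j \<and> i < m" for i j
      using bot[of "Inr i" j] spo(1) spo(2) by (auto simp: refl_on_def)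
    moreover have "(Inl x, Inr j) \<notin> s" for x j using bot by blast
    ultimately show "(p, q) \<in> extension_of_cover r ?us \<longleftrightarrow> (p, q) \<in> s"
      using LL nth len by (cases p; cases q) auto
  qed
qed

lemma num_extensions_eq_card_upset_covers:
  assumes "finite K" "partial_order_on K r"
  shows "num_extensions m K r = card (upset_covers m K r)"
proof -
  have "bij_betw (extension_of_cover r) (upset_covers m K r)
      (extensions_by_minimals (Inr ` {..<m}) (Inl ` K) (map_prod Inl Inl ` r))"
  proof (rule bij_betw_byWitness[where f' = "cover_of_extension m"])
    show "\<forall>us\<in>upset_covers m K r. cover_of_extension m (extension_of_cover r us) = us"
      by (auto simp: upset_covers_def cover_of_extension_of_cover)
  qed (use assms in \<open>auto simp: extension_of_cover_mem extension_has_cover\<close>)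
  then show ?thesis by (simp add: num_extensions_def bij_betw_same_card)
qed

section \<open>Covers with an essential first member\<close>

text \<open>The tail is a list of \<open>m\<close> upsets in any case, so its failure to be a cover
  means exactly that it misses a point of \<open>K\<close>.\<close>

definition essential_head_covers :: "nat \<Rightarrow> 'a set \<Rightarrow> 'a rel \<Rightarrow> 'a set list set" where
  "essential_head_covers m K r =
     {us \<in> upset_covers (Suc m) K r. tl us \<notin> upset_covers m K r}"

text \<open>Split by whether the tail still covers \<open>K\<close>. If it does, the head is an
  arbitrary upset, which gives the product.\<close>

lemma card_upset_covers_Suc:
  assumes "finite K"
  shows "card (upset_covers (Suc m) K r)
    = num_downsets K r * card (upset_covers m K r) + card (essential_head_covers m K r)"
proof -
  let ?A = "(\<lambda>(U, us). U # us) ` (upsets K r \<times> upset_covers m K r)"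
  have "upset_covers (Suc m) K r = ?A \<union> essential_head_covers m K r"
  proof (intro equalityI subsetI)
    fix vs assume vs: "vs \<in> upset_covers (Suc m) K r"
    then obtain U us where "vs = U # us" by (cases vs) (auto simp: upset_covers_def)
    with vs show "vs \<in> ?A \<union> essential_head_covers m K r"
      by (auto simp: essential_head_covers_def upset_covers_def)
  next
    fix vs assume "vs \<in> ?A \<union> essential_head_covers m K r"
    moreover have "U # us \<in> upset_covers (Suc m) K r"
      if "U \<in> upsets K r" "us \<in> upset_covers m K r" for U us
    proof -
      have "U \<union> K = K" using that(1) by (auto simp: upsets_def)
      then show ?thesis using that by (simp add: upset_covers_def)
    qed
    ultimately show "vs \<in> upset_covers (Suc m) K r"
      by (auto simp: essential_head_covers_def)
  qed
  moreover have "?A \<inter> essential_head_covers m K r = {}"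
    by (auto simp: essential_head_covers_def)
  moreover have "card ?A = num_downsets K r * card (upset_covers m K r)"
    by (subst card_image) (auto simp: inj_on_def card_cartesian_product card_upsets)
  moreover have "finite ?A" "finite (essential_head_covers m K r)"
    using assms by (auto simp: essential_head_covers_def finite_upsets finite_upset_covers)
  ultimately show ?thesis by (simp add: card_Un_disjoint)
qed

text \<open>The factor \<open>m\<close> counts the choices of an entry into which the head is
  merged; the pairs of index and cover are then injected into a product of sets.\<close>

lemma card_essential_head_covers_le:
  assumes fin: "finite K"
  shows "m * card (essential_head_covers m K r)
    \<le> card (upset_covers m K r) * (card K * (num_downsets K r * num_downsets K r))"
proof -
  define x where "x vs = (SOME x. x \<in> K - \<Union>(set (tl vs)))" for vs :: "'a set list"
  \<comment> \<open>The components are the merged cover, a point missed by the tail, the head, and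
    the overwritten entry. The last two take part in undoing the merge.\<close>
  define f where
    "f = (\<lambda>(i, vs). ((tl vs)[i := tl vs ! i \<union> hd vs], x vs, hd vs, tl vs ! i))"
  let ?D = "{..<m} \<times> essential_head_covers m K r"
  let ?T = "upset_covers m K r \<times> K \<times> upsets K r \<times> upsets K r"
  have split: "\<exists>U us. vs = U # us \<and> length us = m \<and> U \<in> upsets K r \<and> set us \<subseteq> upsets K r
      \<and> U \<union> \<Union>(set us) = K \<and> x vs \<in> K \<and> x vs \<in> U \<and> x vs \<notin> \<Union>(set us)"
    if vs: "vs \<in> essential_head_covers m K r" for vs
  proof -
    obtain U us where eq: "vs = U # us"
      using vs by (cases vs) (auto simp: essential_head_covers_def upset_covers_def)
    then have c: "length us = m" "U \<in> upsets K r" "set us \<subseteq> upsets K r" "U \<union> \<Union>(set us) = K"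
      using vs by (auto simp: essential_head_covers_def upset_covers_def)
    then have "\<Union>(set us) \<noteq> K"
      using vs eq by (auto simp: essential_head_covers_def upset_covers_def)
    then have "\<exists>x. x \<in> K - \<Union>(set (tl vs))" using c(4) eq by auto
    then have "x vs \<in> K - \<Union>(set (tl vs))" unfolding x_def by (rule someI_ex)
    then show ?thesis using c eq by auto
  qed
  have "f ` ?D \<subseteq> ?T"
  proof (rule image_subsetI)
    fix p assume "p \<in> ?D"
    then obtain i vs where p: "p = (i, vs)" and i: "i < m"
      and vs: "vs \<in> essential_head_covers m K r" by auto
    obtain U us where u: "vs = U # us" "length us = m" "U \<in> upsets K r"
      "set us \<subseteq> upsets K r" "U \<union> \<Union>(set us) = K" "x vs \<in> K" using split[OF vs] by blast
    have ui: "us ! i \<in> upsets K r" using u i by auto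
    let ?w = "us[i := us ! i \<union> U]"
    have up: "set ?w \<subseteq> upsets K r"
      using set_update_subset_insert[of us i] upsets_Un[OF ui u(3)] u(4) by blast
    \<comment> \<open>Points of \<open>U\<close> lie in the merged entry; the others keep their old
      entry, since entries only grow.\<close>
    have "y \<in> \<Union>(set ?w)" if y: "y \<in> K" for y
    proof (cases "y \<in> U")
      case True
      then show ?thesis using i u(2) by (intro UnionI[OF set_update_memI]) auto
    next
      case False
      then obtain j where "j < m" "y \<in> us ! j"
        using y u(2,5) by (auto simp: in_set_conv_nth)
      then have "?w ! j \<in> set ?w" "y \<in> ?w ! j"
        using u(2) by (simp_all, cases "i = j") simp_all
      then show ?thesis by blast
    qed
    moreover have "\<Union>(set ?w) \<subseteq> K" using up by (auto simp: upsets_def)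
    ultimately have "\<Union>(set ?w) = K" by blast
    then have "?w \<in> upset_covers m K r" using up u(2) by (simp add: upset_covers_def)
    then show "f p \<in> ?T" using u ui p by (simp add: f_def)
  qed
  moreover have "inj_on f ?D"
  proof (rule inj_onI)
    fix p q assume pq: "p \<in> ?D" "q \<in> ?D" and eq: "f p = f q"
    obtain i vs where p: "p = (i, vs)" and i: "i < m" "vs \<in> essential_head_covers m K r"
      using pq(1) by auto
    obtain j ws where q: "q = (j, ws)" and j: "j < m" "ws \<in> essential_head_covers m K r"
      using pq(2) by auto
    obtain U us where u: "vs = U # us" "length us = m" "x vs \<in> U" "x vs \<notin> \<Union>(set us)"
      using split[OF i(2)] by blast
    obtain V ts where v: "ws = V # ts" "length ts = m" "x ws \<in> V" "x ws \<notin> \<Union>(set ts)"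
      using split[OF j(2)] by blast
    have e: "us[i := us ! i \<union> U] = ts[j := ts ! j \<union> V]" "x vs = x ws" "U = V" "us ! i = ts ! j"
      using eq p q u(1) v(1) by (auto simp: f_def)
    \<comment> \<open>The marked point lies in \<open>U\<close> but in no entry of the tail, so
      after merging it lies in entry \<open>i\<close> alone and reveals the index.\<close>
    have ij: "i = j"
    proof (rule ccontr)
      assume "i \<noteq> j"
      have "x vs \<in> us[i := us ! i \<union> U] ! i" using i u by simp
      then have "x ws \<in> ts ! i" using e(1,2) \<open>i \<noteq> j\<close> by simp
      then show False using v(2,4) i(1) by auto
    qed
    \<comment> \<open>With the index known, writing the remembered entry back recovers the
      tail.\<close>
    have "us = us[i := us ! i \<union> U, i := us ! i]" by simp
    also have "\<dots> = ts[i := ts ! i \<union> V, i := ts ! i]" using e(1,4) ij by simp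
    also have "\<dots> = ts" by simp
    finally show "p = q" using p q ij u(1) v(1) e(3) by simp
  qed
  moreover have "finite ?T" using fin by (simp add: finite_upsets finite_upset_covers)
  ultimately have "card ?D \<le> card ?T" by (metis card_inj_on_le)
  then show ?thesis by (simp add: card_cartesian_product card_upsets)
qed

section \<open>The bounds on the ratio\<close>

theorem theorem6p4:
  fixes K :: "'a set" and r :: "'a rel" and k m :: nat
  assumes "finite K" and "partial_order_on K r" and "card K = k" and "m \<ge> 1"
  shows "1 \<le> real (num_extensions (m + 1) K r) / (real (num_downsets K r) * real (num_extensions m K r))
       \<and> real (num_extensions (m + 1) K r) / (real (num_downsets K r) * real (num_extensions m K r))
           < 1 + inverse (real m) * 2 ^ k * real (num_downsets K r)
       \<and> 1 + inverse (real m) * 2 ^ k * real (num_downsets K r) \<le> 1 + inverse (real m) * 4 ^ k"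
proof -
  define d where "d = num_downsets K r"
  define e where "e = num_extensions m K r"
  define b where "b = card (essential_head_covers m K r)"
  have e: "e = card (upset_covers m K r)"
    unfolding e_def by (rule num_extensions_eq_card_upset_covers[OF assms(1,2)])
  have step: "num_extensions (m + 1) K r = d * e + b"
    using num_extensions_eq_card_upset_covers[OF assms(1,2), of "Suc m"]
      card_upset_covers_Suc[OF assms(1), of m r]
    by (simp add: e d_def b_def)
  have "e > 0"
    unfolding e using finite_upset_covers[OF assms(1)] upset_covers_nonempty[OF assms(4)]
    by (simp add: card_gt_0_iff)
  moreover have "d > 0"
    using finite_upsets[OF assms(1), of r] ground_set_in_upsets[of K r]
    by (auto simp: d_def card_upsets[symmetric] card_gt_0_iff)
  ultimately have pos: "e > 0" "d > 0" "real d * real e > 0" by simp_all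
  have "m * b \<le> e * (k * (d * d))"
    using card_essential_head_covers_le[OF assms(1), of m r] assms(3) by (simp add: e d_def b_def)
  \<comment> \<open>Strictness comes from \<open>k < 2 ^ k\<close> and the positivity of
    \<open>d\<close> and \<open>e\<close>.\<close>
  also have "\<dots> < e * (2 ^ k * (d * d))" using pos by simp
  finally have "real (m * b) < real (e * (2 ^ k * (d * d)))" by (simp only: of_nat_less_iff)
  \<comment> \<open>One factor \<open>d\<close> is grouped with \<open>e\<close> to form the
    denominator of the ratio; the other stays in the bound.\<close>
  then have "real b < inverse (real m) * 2 ^ k * real d * (real d * real e)"
    using assms(4) by (simp add: field_simps)
  then have "real b / (real d * real e) < inverse (real m) * 2 ^ k * real d"
    using pos(3) by (simp add: pos_divide_less_eq)
  moreover have "real (d * e + b) / (real d * real e) = 1 + real b / (real d * real e)"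
    using pos by (simp add: add_divide_distrib)
  moreover have "real b / (real d * real e) \<ge> 0" by simp
  moreover have "inverse (real m) * 2 ^ k * real d \<le> inverse (real m) * 4 ^ k"
  proof -
    have "real d \<le> 2 ^ k"
      using num_downsets_le[OF assms(1), of r] assms(3)
      by (metis d_def of_nat_le_iff of_nat_numeral of_nat_power)
    then have "inverse (real m) * 2 ^ k * real d \<le> inverse (real m) * 2 ^ k * 2 ^ k"
      by (intro mult_left_mono) auto
    also have "\<dots> = inverse (real m) * 4 ^ k"
      by (simp add: power_mult_distrib[symmetric])
    finally show ?thesis .
  qed
  ultimately show ?thesis unfolding step d_def[symmetric] e_def[symmetric] by linarith
qed

end
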